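(* Let $G$ be a subgroup of the symmetric group $S_n$. If $\mathbf{a}$ and $\mathbf{b}$ are vectors in $\mathbb{R}^n$ with nonnegative coordinates such that \[ [\mathbf{x}^{\mathbf{b}}]_G \le [\mathbf{x}^{\mathbf{a}}]_G \] for every vector $\mathbf{x} \in \mathbb{R}^n$ with positive coordinates, then $\mathbf{b} \in K_G(\mathbf{a})$, the convex hull of the finite set $\{\gamma\mathbf{a} : \gamma \in G\}$.
   Context: $S_n$ acts on $\mathbb{R}^n$ by $\gamma (a_1,\ldots,a_n)^T = (a_{\gamma^{-1}(1)},\ldots,a_{\gamma^{-1}(n)})^T$. For a nonnegative vector $\mathbf{a}$ and a vector $\mathbf{x}=(x_1,\ldots,x_n)^T$ with positive coordinates, $[\mathbf{x}^{\mathbf{a}}]_G = \frac{1}{|G|}\sum_{\sigma\in G} x_{\sigma(1)}^{a_1}\cdots x_{\sigma(n)}^{a_n}$. *)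

theory Defs
  imports "HOL-Analysis.Analysis" "HOL-Algebra.Bij"
begin

(* The coordinates of R^n are indexed by the n-element type 'n, so S_n is BijGroup (UNIV :: 'n set).
   inv_into UNIV is the inverse function; it is written out because HOL-Algebra also claims the
   syntax inv. *)

definition perm_act :: "('n::finite \<Rightarrow> 'n) \<Rightarrow> real ^ 'n \<Rightarrow> real ^ 'n" where
  "perm_act \<gamma> a = (\<chi> i. a $ (inv_into UNIV \<gamma> i))"

definition group_mean :: "('n::finite \<Rightarrow> 'n) set \<Rightarrow> real ^ 'n \<Rightarrow> real ^ 'n \<Rightarrow> real" where
  "group_mean G a x = (1 / real (card G)) * (\<Sum>\<sigma>\<in>G. \<Prod>i\<in>UNIV. (x $ \<sigma> i) powr (a $ i))"

definition K_hull :: "('n::finite \<Rightarrow> 'n) set \<Rightarrow> real ^ 'n \<Rightarrow> (real ^ 'n) set" where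
  "K_hull G a = convex hull ((\<lambda>\<gamma>. perm_act \<gamma> a) ` G)"

end

theory Submission
  imports Defs
begin

text \<open>
  If \<open>b\<close> is not in the hull, a hyperplane separates it strictly from the hull: \<open>z \<bullet> b < c\<close>, while
  \<open>z \<bullet> \<gamma> a > c\<close> for all \<open>\<gamma> \<in> G\<close>. At \<open>x\<^sub>i = exp (- t * z\<^sub>i)\<close> the monomial of \<open>\<sigma>\<close> is
  \<open>exp (- t * (z \<bullet> \<sigma> a))\<close>, so the mean inequality yields
  \<open>exp (- t * (z \<bullet> b)) \<le> card G * exp (- t * c)\<close>, which fails for large \<open>t\<close>.
\<close>

text \<open>Reindexing by \<open>j = \<sigma> i\<close> cancels the inverse in
  \<open>perm_act\<close>. The permutation moves from \<open>a\<close> to \<open>z\<close>, matching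
  the factors \<open>x $ \<sigma> i\<close> of \<open>group_mean\<close>.\<close>

lemma inner_perm_act:
  fixes z a :: "real ^ 'n::finite"
  assumes "bij \<sigma>"
  shows "z \<bullet> perm_act \<sigma> a = (\<Sum>i\<in>UNIV. z $ \<sigma> i * a $ i)"
proof -
  have "z \<bullet> perm_act \<sigma> a = (\<Sum>j\<in>UNIV. z $ j * a $ inv_into UNIV \<sigma> j)"
    by (simp add: inner_vec_def perm_act_def)
  also have "\<dots> = (\<Sum>i\<in>UNIV. z $ \<sigma> i * a $ inv_into UNIV \<sigma> (\<sigma> i))"
    using sum.reindex_bij_betw[OF assms, of "\<lambda>j. z $ j * a $ inv_into UNIV \<sigma> j"] by simp
  finally show ?thesis
    using assms by (simp add: bij_is_inj)
qed

lemma monomial_at_exp: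
  fixes z a :: "real ^ 'n::finite"
  assumes "bij \<sigma>"
  shows "(\<Prod>i\<in>UNIV. ((\<chi> j. exp (- t * z $ j)) $ \<sigma> i) powr (a $ i)) = exp (- t * (z \<bullet> perm_act \<sigma> a))"
  by (simp add: inner_perm_act[OF assms] powr_def exp_sum[symmetric] sum_distrib_left
      sum_negf[symmetric] mult_ac)

theorem mainTheorem11:
  fixes G :: "('n::finite \<Rightarrow> 'n) set" and a b :: "real ^ 'n"
  assumes "subgroup G (BijGroup (UNIV :: 'n set))"
    and "\<And>i. a $ i \<ge> 0"
    and "\<And>i. b $ i \<ge> 0"
    and "\<And>x :: real ^ 'n. (\<And>i. x $ i > 0) \<Longrightarrow> group_mean G b x \<le> group_mean G a x"
  shows "b \<in> K_hull G a"
proof (rule ccontr)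
  assume "b \<notin> K_hull G a"
  have bij: "bij \<sigma>" if "\<sigma> \<in> G" for \<sigma>
    using subgroup.subset[OF assms(1)] that by (auto simp: BijGroup_def Bij_def)
  have id: "id \<in> G"
    using subgroup.one_closed[OF assms(1)] by (simp add: BijGroup_def id_def restrict_def)
  have fin: "finite G" by simp
  have card: "real (card G) > 0"
    using id fin by (auto simp: card_gt_0_iff)
  \<comment> \<open>The hull of finitely many points is compact, hence closed, so strict separation
    applies.\<close>
  have "convex (K_hull G a)" "closed (K_hull G a)"
    by (simp_all add: K_hull_def compact_imp_closed finite_imp_compact_convex_hull)
  then obtain z c where zb: "z \<bullet> b < c" and z: "\<And>y. y \<in> K_hull G a \<Longrightarrow> z \<bullet> y > c"
    using separating_hyperplane_closed_point \<open>b \<notin> K_hull G a\<close> by metis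
  \<comment> \<open>Chosen so that \<open>t * (c - z \<bullet> b) = card G\<close>: the final bound
    becomes \<open>exp (card G) \<le> card G\<close>, against
    \<open>exp u \<ge> 1 + u\<close>.\<close>
  define t where "t = real (card G) / (c - z \<bullet> b)"
  have t: "t > 0" using card zb by (simp add: t_def)
  define x :: "real ^ 'n" where "x = (\<chi> j. exp (- t * z $ j))"
  have mean: "group_mean G d x = (\<Sum>\<sigma>\<in>G. exp (- t * (z \<bullet> perm_act \<sigma> d))) / card G" for d
    using bij by (simp add: group_mean_def x_def monomial_at_exp[simplified])
  have "group_mean G b x \<le> group_mean G a x"
    by (rule assms(4)) (simp add: x_def)
  then have le: "(\<Sum>\<sigma>\<in>G. exp (- t * (z \<bullet> perm_act \<sigma> b))) \<le> (\<Sum>\<sigma>\<in>G. exp (- t * (z \<bullet> perm_act \<sigma> a)))"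
    using card by (simp add: mean divide_le_cancel)
  \<comment> \<open>All terms are positive, so the sum for \<open>b\<close> is at least its identity
    term.\<close>
  have "exp (- t * (z \<bullet> b)) = exp (- t * (z \<bullet> perm_act id b))"
    by (simp add: perm_act_def)
  also have "\<dots> \<le> (\<Sum>\<sigma>\<in>G. exp (- t * (z \<bullet> perm_act \<sigma> b)))"
    using id fin by (intro member_le_sum[where f = "\<lambda>\<sigma>. exp (- t * (z \<bullet> perm_act \<sigma> b))"]) auto
  also note le
  also have "(\<Sum>\<sigma>\<in>G. exp (- t * (z \<bullet> perm_act \<sigma> a))) \<le> (\<Sum>\<sigma>\<in>G. exp (- t * c))"
  proof (rule sum_mono)
    fix \<sigma> assume "\<sigma> \<in> G"
    then have "z \<bullet> perm_act \<sigma> a > c"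
      by (intro z) (simp add: K_hull_def hull_inc)
    then show "exp (- t * (z \<bullet> perm_act \<sigma> a)) \<le> exp (- t * c)"
      using t by simp
  qed
  also have "\<dots> = card G * exp (- t * c)" by simp
  \<comment> \<open>The factor \<open>exp (t * c)\<close> cancels the decay on the right and leaves
    the gap \<open>c - z \<bullet> b\<close> in the exponent on the left.\<close>
  finally have "exp (- t * (z \<bullet> b)) * exp (t * c) \<le> card G * exp (- t * c) * exp (t * c)"
    by (intro mult_right_mono) auto
  then have "exp (t * (c - z \<bullet> b)) \<le> card G"
    by (simp add: mult.assoc exp_add[symmetric] algebra_simps)
  moreover have "t * (c - z \<bullet> b) = card G"
    using zb by (simp add: t_def)
  ultimately show False
    using exp_ge_add_one_self[of "real (card G)"] by simp
qed

end
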